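(* Let $c\in[0,1]$ and $t\in\mathbb{R}$. As $p+q\to\infty$ with $(p,q)\in\mathbf{N}$ such that $\frac{p}{p+q}\to c$, $$m_{\Lambda^*_{p,q}}(t)\longrightarrow\frac{e^{3t}}{\pi}\int_0^\pi e^{2t\cos\theta}\,I_0\left(4t\cos\frac{\theta}{2}\right)d\theta,$$ where $m_{\Lambda^*_{p,q}}(t)=\mathbb{E}\exp(t\Lambda^*_{p,q})$.
   Context: $\mathbb{N}_0=\{0,1,2,\ldots\}$ and $\mathbf{N}:=\{(p,q)\in\mathbb{N}_0^2 : p+q\ge 5,\ q\le p\}$. For such $(p,q)$, $\Lambda^*_{p,q}$ denotes the random eigenvalue of the dual infinite $(p,q)$-nanotube (the triangular lattice with a loop of weight $3$ at each vertex, rolled up along the chiral vector $(p,q)$), i.e. the real random variable with compactly supported distribution whose moments $\mu_k(\Lambda^*_{p,q})=\mathbb{E}(\Lambda^*_{p,q})^k$, $k\in\mathbb{N}_0$, are the (weighted) numbers of closed paths with $k$ steps from a vertex of this graph, given by $$\mu_k(\Lambda^*_{p,q})=\frac{1}{(2\pi)^3}\sum_{j\in\mathbb{Z}}\int_{-\pi}^{\pi}\int_{-\pi}^{\pi}\int_{-\pi}^{\pi}\left|e^{ix}+e^{iy}+e^{iz}\right|^{2k}e^{ij(p(x-z)+q(y-z))}\,dx\,dy\,dz .$$ For each fixed $k$ only finitely many terms of the sum are non-zero, and these moments determine the (compactly supported) distribution of $\Lambda^*_{p,q}$ uniquely. $I_0(x)=\sum_{k=0}^\infty\frac{1}{(k!)^2}\left(\frac{x}{2}\right)^{2k}$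 is the modified Bessel function of the first kind of order $0$. *)

theory Defs
  imports "HOL-Probability.Probability"
begin

definition nanotube_params :: "(nat \<times> nat) set" where
  "nanotube_params = {(p, q). p + q \<ge> 5 \<and> q \<le> p}"

(* Weighted number of closed paths with k steps from a vertex of the dual (p,q)-nanotube.
   Only finitely many of the summands over j are non-zero, so the infinite sum is a finite one.
   It is real, but the summands are written as complex numbers. *)
definition dual_nanotube_moment :: "nat \<Rightarrow> nat \<Rightarrow> nat \<Rightarrow> complex" where
  "dual_nanotube_moment p q k =
     1 / (2 * of_real pi) ^ 3 *
     (\<Sum>\<^sub>\<infinity>j::int.
        integral {-pi..pi} (\<lambda>z. integral {-pi..pi} (\<lambda>y. integral {-pi..pi} (\<lambda>x.
          of_real (norm (exp (\<i> * of_real x) + exp (\<i> * of_real y) + exp (\<i> * of_real z)) ^ (2 * k)) *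
          exp (\<i> * of_int j * of_real (real p * (x - z) + real q * (y - z)))))))"

definition compactly_supported_rv :: "'a measure \<Rightarrow> ('a \<Rightarrow> real) \<Rightarrow> bool" where
  "compactly_supported_rv M X \<longleftrightarrow> (\<exists>K. compact K \<and> (AE \<omega> in M. X \<omega> \<in> K))"

(* The random eigenvalue is specified only up to its distribution, which the moments determine;
   the underlying probability space is therefore arbitrary. *)
definition dual_nanotube_eigenvalue :: "nat \<Rightarrow> nat \<Rightarrow> 'a measure \<Rightarrow> ('a \<Rightarrow> real) \<Rightarrow> bool" where
  "dual_nanotube_eigenvalue p q M X \<longleftrightarrow>
     prob_space M \<and> X \<in> borel_measurable M \<and> compactly_supported_rv M X \<and>
     (\<forall>k. complex_of_real (\<integral>\<omega>. X \<omega> ^ k \<partial>M) = dual_nanotube_moment p q k)"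

definition mgf :: "'a measure \<Rightarrow> ('a \<Rightarrow> real) \<Rightarrow> real \<Rightarrow> real" where
  "mgf M X t = (\<integral>\<omega>. exp (t * X \<omega>) \<partial>M)"

definition bessel_I0 :: "real \<Rightarrow> real" where
  "bessel_I0 x = (\<Sum>k. 1 / (fact k)\<^sup>2 * (x / 2) ^ (2 * k))"

end

theory Submission
  imports Defs
begin

text \<open>
  The integral over \<open>x\<close> in the \<open>j\<close>-th summand of the \<open>k\<close>-th moment is that of a trigonometric
  polynomial of degree at most \<open>k\<close> against frequency \<open>j p\<close>. Hence it vanishes when \<open>\<bar>j\<bar> p > k\<close>, so
  for \<open>p > k\<close> the moment is that of the planar triangular lattice, and it is always at most
  \<open>(2 k + 1) 9\<^sup>k\<close> in modulus. As \<open>p \<ge> (p + q) / 2 \<rightarrow> \<infinity>\<close>, Tannery's theorem gives convergence of the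
  moment generating functions. For the limit, translation by the argument of \<open>e\<^sup>i\<^sup>y + e\<^sup>i\<^sup>z\<close>, whose
  modulus is \<open>2 \<bar>cos ((y - z) / 2)\<bar>\<close>, removes one of the three integrals, and the integral over \<open>x\<close>
  of the resulting exponential is a Bessel function.
\<close>

section \<open>Orthogonality of exponentials to trigonometric polynomials\<close>

lemma exp_int_has_integral_0:
  fixes m :: int
  assumes "m \<noteq> 0"
  shows "((\<lambda>x. exp (\<i> * of_int m * of_real x)) has_integral 0) {-pi..pi}"
proof -
  let ?F = "\<lambda>x::real. exp (\<i> * of_int m * of_real x) / (\<i> * of_int m)"
  have "((\<lambda>x. exp (\<i> * of_int m * of_real x)) has_integral ?F pi - ?F (-pi)) {-pi..pi}"
  proof (rule fundamental_theorem_of_calculus)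
    fix x :: real
    have "((\<lambda>z. exp (\<i> * of_int m * z) / (\<i> * of_int m)) has_field_derivative
             exp (\<i> * of_int m * of_real x)) (at (of_real x))"
      using assms by (auto intro!: derivative_eq_intros)
    then have "((\<lambda>z. exp (\<i> * of_int m * z) / (\<i> * of_int m)) \<circ> complex_of_real
        has_vector_derivative 1 * exp (\<i> * of_int m * of_real x)) (at x within {-pi..pi})"
      by (intro field_vector_diff_chain_at[THEN has_vector_derivative_at_within] has_vector_derivative_of_real)
         (auto intro!: derivative_eq_intros)
    then show "(?F has_vector_derivative exp (\<i> * of_int m * of_real x)) (at x within {-pi..pi})"
      by (simp add: o_def)
  qed auto
  moreover have "exp (\<i> * of_int m * of_real pi) = exp (\<i> * of_int m * of_real (-pi))"
    by (rule exp_eq[THEN iffD2], rule exI[of _ m]) (simp add: algebra_simps)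
  ultimately show ?thesis by simp
qed

text \<open>Expanding the power leaves only frequencies within distance \<open>k\<close> of
  \<open>m\<close>, and none of them is 0. The induction peels off one factor instead: it moves
  \<open>m\<close> by at most 1, so \<open>m\<close> has to vary in the induction
  hypothesis.\<close>

lemma laurent_power_orthogonal:
  fixes m :: int and A B C :: complex
  assumes "int k < \<bar>m\<bar>"
  shows "((\<lambda>x. (A + B * exp (\<i> * of_real x) + C * exp (- (\<i> * of_real x))) ^ k *
            exp (\<i> * of_int m * of_real x)) has_integral 0) {-pi..pi}"
  using assms
proof (induction k arbitrary: m)
  case 0
  then show ?case using exp_int_has_integral_0[of m] by simp
next
  case (Suc k)
  let ?P = "\<lambda>x::real. A + B * exp (\<i> * of_real x) + C * exp (- (\<i> * of_real x))"
  let ?e = "\<lambda>m x. exp (\<i> * of_int m * of_real x)"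
  have IH: "((\<lambda>x. c * (?P x ^ k * ?e l x)) has_integral 0) {-pi..pi}"
    if "l \<in> {m - 1, m, m + 1}" for l c
    using Suc.IH[of l, THEN has_integral_mult_right, of c] that Suc.prems by auto
  have "((\<lambda>x. A * (?P x ^ k * ?e m x) + B * (?P x ^ k * ?e (m + 1) x) + C * (?P x ^ k * ?e (m - 1) x))
      has_integral 0 + 0 + 0) {-pi..pi}"
    by (intro has_integral_add IH) auto
  moreover have "A * (?P x ^ k * ?e m x) + B * (?P x ^ k * ?e (m + 1) x) + C * (?P x ^ k * ?e (m - 1) x)
      = ?P x ^ Suc k * ?e m x" for x
  proof -
    have "?e (m + 1) x = exp (\<i> * of_real x) * ?e m x" "?e (m - 1) x = exp (- (\<i> * of_real x)) * ?e m x"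
      by (simp_all add: algebra_simps flip: exp_add)
    then show ?thesis by (simp add: algebra_simps)
  qed
  ultimately show ?case by simp
qed

section \<open>Integrals of powers of the cosine and the Bessel function\<close>

text \<open>The difference of the two integrands is the derivative of
  \<open>sin x * cos x ^ (n + 1)\<close>, which vanishes at both ends of the interval.\<close>

lemma cos_power_recurrence:
  "real (n + 2) * integral {-pi..pi} (\<lambda>x. cos x ^ (n + 2)) =
   real (n + 1) * integral {-pi..pi} (\<lambda>x. cos x ^ n)"
proof -
  let ?F = "\<lambda>x::real. sin x * cos x ^ (n + 1)"
  have "((\<lambda>x. real (n + 2) * cos x ^ (n + 2) - real (n + 1) * cos x ^ n)
          has_integral ?F pi - ?F (-pi)) {-pi..pi}"
  proof (rule fundamental_theorem_of_calculus)
    fix x :: real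
    have "(?F has_real_derivative
        cos x * cos x ^ (n + 1) - sin x * (real (n + 1) * cos x ^ n * sin x)) (at x within {-pi..pi})"
      using DERIV_mult[OF has_field_derivative_at_within[OF DERIV_sin]
          DERIV_power_Suc[OF has_field_derivative_at_within[OF DERIV_cos]], of n x "{-pi..pi}"]
      by (simp add: algebra_simps)
    moreover have "cos x * cos x ^ (n + 1) - sin x * (real (n + 1) * cos x ^ n * sin x) =
        cos x ^ (n + 2) - real (n + 1) * cos x ^ n * (sin x)\<^sup>2"
      by (simp add: power2_eq_square)
    also have "\<dots> = real (n + 2) * cos x ^ (n + 2) - real (n + 1) * cos x ^ n"
      unfolding sin_squared_eq by (simp add: algebra_simps power2_eq_square)
    finally show "(?F has_vector_derivative
        real (n + 2) * cos x ^ (n + 2) - real (n + 1) * cos x ^ n) (at x within {-pi..pi})"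
      unfolding has_real_derivative_iff_has_vector_derivative by simp
  qed auto
  then have "integral {-pi..pi} (\<lambda>x. real (n + 2) * cos x ^ (n + 2) - real (n + 1) * cos x ^ n) = 0"
    by (simp add: integral_unique)
  then show ?thesis
    by (subst (asm) integral_diff) (auto intro!: integrable_continuous_real continuous_intros)
qed

lemma integral_cos_odd_power: "integral {-pi..pi} (\<lambda>x::real. cos x ^ (2 * k + 1)) = 0"
proof (induction k)
  case 0
  have "((\<lambda>x::real. cos x) has_integral sin pi - sin (-pi)) {-pi..pi}"
    by (rule fundamental_theorem_of_calculus)
       (auto intro!: derivative_eq_intros simp flip: has_real_derivative_iff_has_vector_derivative)
  then show ?case by (simp add: integral_unique)
next
  case (Suc k)
  then show ?case using cos_power_recurrence[of "2 * k + 1"] by simp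
qed

text \<open>The mean value is the central binomial coefficient over \<open>4 ^ k\<close>. Written
  with factorials, its numerator cancels the \<open>fact (2 * k)\<close> of the exponential series
  and leaves the coefficients of \<open>bessel_I0\<close>.\<close>

lemma integral_cos_even_power:
  "integral {-pi..pi} (\<lambda>x::real. cos x ^ (2 * k)) = 2 * pi * fact (2 * k) / (4 ^ k * (fact k)\<^sup>2)"
proof (induction k)
  case 0
  then show ?case by simp
next
  case (Suc k)
  have "integral {-pi..pi} (\<lambda>x::real. cos x ^ (2 * Suc k)) =
      real (2 * k + 1) / real (2 * k + 2) * integral {-pi..pi} (\<lambda>x. cos x ^ (2 * k))"
    using cos_power_recurrence[of "2 * k"] by (simp add: field_simps)
  also have "\<dots> = real (2 * k + 1) / (2 * real (k + 1)) * (2 * pi * fact (2 * k) / (4 ^ k * (fact k)\<^sup>2))"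
    unfolding Suc.IH by simp
  also have "\<dots> = 2 * pi * (2 * real (k + 1) * real (2 * k + 1) * fact (2 * k)) /
      (4 ^ Suc k * (real (k + 1) * fact k)\<^sup>2)"
    by (simp add: divide_simps power2_eq_square del: of_nat_add of_nat_Suc)
  also have "2 * real (k + 1) * real (2 * k + 1) * fact (2 * k) = fact (2 * Suc k)"
    by simp
  also have "real (k + 1) * fact k = fact (Suc k)"
    by simp
  finally show ?case .
qed

text \<open>The Weierstrass M-test makes the partial sums converge uniformly, and uniform limits
  commute with integration over a compact interval.\<close>

lemma sums_integral_uniform:
  fixes f :: "nat \<Rightarrow> real \<Rightarrow> real"
  assumes "\<And>n. continuous_on {a..b} (f n)"
    and "\<And>n x. x \<in> {a..b} \<Longrightarrow> \<bar>f n x\<bar> \<le> B n" and "summable B"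
  shows "(\<lambda>n. integral {a..b} (f n)) sums integral {a..b} (\<lambda>x. \<Sum>n. f n x)"
proof -
  have "uniform_limit {a..b} (\<lambda>n x. \<Sum>i<n. f i x) (\<lambda>x. \<Sum>i. f i x) sequentially"
    using assms by (intro Weierstrass_m_test) auto
  then obtain I J where "\<And>n. ((\<lambda>x. \<Sum>i<n. f i x) has_integral I n) {a..b}"
      and J: "((\<lambda>x. \<Sum>i. f i x) has_integral J) {a..b}" "I \<longlonglongrightarrow> J"
    by (rule uniform_limit_integral) (auto intro!: continuous_intros assms(1))
  then have "I n = (\<Sum>i<n. integral {a..b} (f i))" for n
    using integral_sum[of "{..<n}" f "{a..b}"] assms(1)
    by (metis finite_lessThan integrable_continuous_real integral_unique)
  then have "I = (\<lambda>n. \<Sum>i<n. integral {a..b} (f i))"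
    by blast
  then show ?thesis
    using J by (simp add: sums_def integral_unique)
qed

text \<open>Termwise integration of the exponential series; the odd powers of the cosine contribute
  nothing, so the sum is reindexed over even exponents.\<close>

lemma integral_exp_cos_eq_bessel_I0:
  "integral {-pi..pi} (\<lambda>x. exp (s * cos x)) = 2 * pi * bessel_I0 s"
proof -
  let ?f = "\<lambda>n x. s ^ n / fact n * cos x ^ n"
  have "(\<lambda>n. integral {-pi..pi} (?f n)) sums integral {-pi..pi} (\<lambda>x. \<Sum>n. ?f n x)"
  proof (rule sums_integral_uniform)
    show "summable (\<lambda>n. \<bar>s\<bar> ^ n / fact n)"
      using summable_exp[of "\<bar>s\<bar>"] by (simp add: divide_inverse mult.commute)
    show "\<bar>?f n x\<bar> \<le> \<bar>s\<bar> ^ n / fact n" for n x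
      by (simp add: abs_mult power_abs divide_right_mono mult_left_le power_le_one)
  qed (auto intro!: continuous_intros)
  moreover have "(\<Sum>n. ?f n x) = exp (s * cos x)" for x
    by (simp add: exp_def power_mult_distrib divide_inverse mult_ac)
  ultimately have sums: "(\<lambda>n. s ^ n / fact n * integral {-pi..pi} (\<lambda>x. cos x ^ n)) sums
      integral {-pi..pi} (\<lambda>x. exp (s * cos x))"
    by simp
  have "(\<lambda>k. s ^ (2 * k) / fact (2 * k) * integral {-pi..pi} (\<lambda>x. cos x ^ (2 * k))) sums
      integral {-pi..pi} (\<lambda>x. exp (s * cos x))"
  proof (subst sums_mono_reindex)
    show "strict_mono (\<lambda>k::nat. 2 * k)" by (simp add: strict_mono_def)
    fix n :: nat assume "n \<notin> range (\<lambda>k. 2 * k)"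
    then have "odd n" by auto
    then show "s ^ n / fact n * integral {-pi..pi} (\<lambda>x. cos x ^ n) = 0"
      using integral_cos_odd_power by (auto elim!: oddE)
  qed (use sums in simp)
  moreover have "s ^ (2 * k) / fact (2 * k) * integral {-pi..pi} (\<lambda>x. cos x ^ (2 * k)) =
      2 * pi * (1 / (fact k)\<^sup>2 * (s / 2) ^ (2 * k))" for k
  proof -
    have "(s / 2) ^ (2 * k) = s ^ (2 * k) / 4 ^ k"
      by (simp add: power_divide power_mult[of 2 2 k])
    then show ?thesis unfolding integral_cos_even_power by (simp add: mult_ac)
  qed
  ultimately have "(\<lambda>k. 2 * pi * (1 / (fact k)\<^sup>2 * (s / 2) ^ (2 * k))) sums
      integral {-pi..pi} (\<lambda>x. exp (s * cos x))"
    by simp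
  then have "(\<lambda>k. 1 / (fact k)\<^sup>2 * (s / 2) ^ (2 * k)) sums
      (integral {-pi..pi} (\<lambda>x. exp (s * cos x)) / (2 * pi))"
    using sums_divide[where c = "2 * pi"] by fastforce
  then show ?thesis
    by (simp add: bessel_I0_def sums_unique[symmetric])
qed

section \<open>Translation invariance of integrals over a period\<close>

text \<open>With \<open>F\<close> an antiderivative of \<open>f\<close>, the derivative of
  \<open>F (pi + a) - F (-pi + a)\<close> in \<open>a\<close> is
  \<open>f (pi + a) - f (-pi + a)\<close>, which is 0 by periodicity. Hence the integral over the
  window shifted by \<open>a\<close> is the same for \<open>a = -s\<close> and
  \<open>a = 0\<close>.\<close>

lemma integral_shift_periodic:
  fixes f :: "real \<Rightarrow> real"
  assumes cont: "continuous_on UNIV f" and per: "\<And>x. f (x + 2 * pi) = f x"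
  shows "integral {-pi..pi} (\<lambda>x. f (x - s)) = integral {-pi..pi} f"
proof -
  \<comment> \<open>Large enough for every window shifted by at most \<open>\<bar>s\<bar>\<close> to
    lie in \<open>{-R..R}\<close>, where \<open>F\<close> is an antiderivative.\<close>
  define R where "R = \<bar>s\<bar> + 2 * pi"
  define F where "F x = integral {-R..x} f" for x
  have F: "(F has_real_derivative f x) (at x within {-R..R})" if "x \<in> {-R..R}" for x
    unfolding F_def using that cont
    by (intro integral_has_real_derivative) (auto intro: continuous_on_subset)
  have int: "integral {-pi + a..pi + a} f = F (pi + a) - F (-pi + a)" if "\<bar>a\<bar> \<le> \<bar>s\<bar>" for a
  proof (rule integral_unique, rule fundamental_theorem_of_calculus)
    fix x assume "x \<in> {-pi + a..pi + a}"
    then show "(F has_vector_derivative f x) (at x within {-pi + a..pi + a})"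
      unfolding has_real_derivative_iff_has_vector_derivative[symmetric]
      using that pi_gt_zero by (intro DERIV_subset[OF F]) (auto simp: R_def abs_le_iff)
  qed simp
  have "F (pi + a) - F (-pi + a) = F pi - F (-pi)" if "a \<in> {-\<bar>s\<bar>..\<bar>s\<bar>}" for a
  proof -
    have D: "((\<lambda>a. F (pi + a) - F (-pi + a)) has_real_derivative 0) (at a within {-\<bar>s\<bar>..\<bar>s\<bar>})"
      if a: "a \<in> {-\<bar>s\<bar>..\<bar>s\<bar>}" for a
    proof -
      have "((\<lambda>a. F (c + a)) has_real_derivative f (c + a)) (at a within {-\<bar>s\<bar>..\<bar>s\<bar>})"
        if "c \<in> {pi, -pi}" for c
      proof -
        have "c + b \<in> {-R..R}" if "b \<in> {-\<bar>s\<bar>..\<bar>s\<bar>}" for b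
          using that \<open>c \<in> {pi, -pi}\<close> pi_gt_zero unfolding R_def atLeastAtMost_iff insert_iff empty_iff
          by (elim disjE conjE FalseE; intro conjI; linarith)
        then have "((+) c) ` {-\<bar>s\<bar>..\<bar>s\<bar>} \<subseteq> {-R..R}" "c + a \<in> {-R..R}"
          using a by blast+
        then have "(F has_real_derivative f (c + a)) (at (c + a) within ((+) c) ` {-\<bar>s\<bar>..\<bar>s\<bar>})"
          by (intro DERIV_subset[OF F])
        then have "(F \<circ> (+) c has_real_derivative f (c + a) * 1) (at a within {-\<bar>s\<bar>..\<bar>s\<bar>})"
          by (rule DERIV_image_chain) (auto intro!: derivative_eq_intros)
        then show ?thesis by (simp add: o_def)
      qed
      from DERIV_diff[OF this[of pi] this[of "-pi"]]
      show ?thesis using per[of "-pi + a"] by (simp add: add_ac)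
    qed
    obtain k where "\<And>a. a \<in> {-\<bar>s\<bar>..\<bar>s\<bar>} \<Longrightarrow> F (pi + a) - F (-pi + a) = k"
      using has_field_derivative_zero_constant[OF _ D] by blast
    from this[of a] this[of 0] that show ?thesis by simp
  qed
  from this[of "-s"] have "integral {-pi - s..pi - s} f = integral {-pi..pi} f"
    using int[of "-s"] int[of 0] abs_ge_self[of s] abs_ge_minus_self[of s] by simp
  moreover have "integral {-pi..pi} (\<lambda>x. f (x - s)) = integral {-pi - s..pi - s} f"
    using integral_shift_Icc_real[of "-pi" pi f "-s"] by (simp add: o_def)
  ultimately show ?thesis by simp
qed

section \<open>Moments of the planar triangular lattice\<close>

text \<open>The value of \<open>\<bar>e\<^sup>i\<^sup>x + e\<^sup>i\<^sup>y + e\<^sup>i\<^sup>z\<bar>\<^sup>2\<close> with \<open>u = y - z\<close> and \<open>x\<close> measured from the argument of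
  \<open>e\<^sup>i\<^sup>y + e\<^sup>i\<^sup>z\<close>. The absolute value makes it \<open>2 \<pi>\<close>-periodic in \<open>u\<close>.\<close>

definition triangular_kernel :: "real \<Rightarrow> real \<Rightarrow> real" where
  "triangular_kernel u x = 3 + 2 * cos u + 4 * \<bar>cos (u / 2)\<bar> * cos x"

lemma triangular_kernel_bound: "\<bar>triangular_kernel u x\<bar> \<le> 9"
proof -
  have "\<bar>triangular_kernel u x\<bar> \<le> 3 + 2 * \<bar>cos u\<bar> + 4 * (\<bar>cos (u / 2)\<bar> * \<bar>cos x\<bar>)"
    unfolding triangular_kernel_def
    using abs_triangle_ineq[of "3 + 2 * cos u" "4 * \<bar>cos (u / 2)\<bar> * cos x"]
      abs_triangle_ineq[of 3 "2 * cos u"] by (simp add: abs_mult)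
  moreover have "\<bar>cos (u / 2)\<bar> * \<bar>cos x\<bar> \<le> 1"
    by (intro mult_le_one) auto
  moreover have "\<bar>cos u\<bar> \<le> 1" by simp
  ultimately show ?thesis by linarith
qed

lemma continuous_on_integral_kernel:
  fixes \<phi> :: "real \<Rightarrow> real"
  assumes "continuous_on UNIV \<phi>"
  shows "continuous_on A (\<lambda>u. integral {-pi..pi} (\<lambda>x. \<phi> (triangular_kernel u x)))"
proof -
  have "continuous_on (A \<times> cbox (-pi) pi) (\<lambda>(u, x). \<phi> (triangular_kernel u x))"
    unfolding triangular_kernel_def split_beta
    by (rule continuous_on_compose2[OF assms]) (auto intro!: continuous_intros)
  from integral_continuous_on_param[OF this] show ?thesis by simp
qed

text \<open>These are the weighted numbers of closed paths in the lattice before it is rolled up.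
  One of the three integrations is already done, which leaves the normalisation
  \<open>(2 * pi)\<^sup>2\<close>.\<close>

definition triangular_moment :: "nat \<Rightarrow> real" where
  "triangular_moment k =
     integral {-pi..pi} (\<lambda>u. integral {-pi..pi} (\<lambda>x. triangular_kernel u x ^ k)) / (2 * pi)\<^sup>2"

text \<open>By the law of cosines the squared modulus depends on \<open>x\<close> only through
  \<open>cos (x - Arg w)\<close>, and the shift by \<open>Arg w\<close> does not change an integral
  over a full period.\<close>

lemma integral_norm_exp_add:
  "((\<lambda>x. norm (exp (\<i> * of_real x) + w) ^ (2 * k)) has_integral
     integral {-pi..pi} (\<lambda>x. (1 + (norm w)\<^sup>2 + 2 * norm w * cos x) ^ k)) {-pi..pi}"
proof -
  define f where "f x = (1 + (norm w)\<^sup>2 + 2 * norm w * cos x) ^ k" for x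
  have "norm (exp (\<i> * of_real x) + w) ^ (2 * k) = f (x - Arg w)" for x
  proof -
    define r a where "r = norm w" and "a = Arg w"
    have w: "w = rcis r a" by (simp add: r_def a_def rcis_cmod_Arg)
    have "(norm (exp (\<i> * of_real x) + w))\<^sup>2 = (cos x + r * cos a)\<^sup>2 + (sin x + r * sin a)\<^sup>2"
      by (simp add: cmod_power2 w flip: cis_conv_exp)
    also have "\<dots> = (sin x)\<^sup>2 + (cos x)\<^sup>2 + r\<^sup>2 * ((sin a)\<^sup>2 + (cos a)\<^sup>2) +
        2 * r * (cos x * cos a + sin x * sin a)"
      by algebra
    also have "\<dots> = 1 + r\<^sup>2 + 2 * r * cos (x - a)"
      by (simp add: cos_diff)
    finally show ?thesis by (simp add: f_def r_def a_def power_mult)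
  qed
  moreover have "(\<lambda>x. f (x - Arg w)) integrable_on {-pi..pi}"
    unfolding f_def by (intro integrable_continuous_real continuous_intros)
  moreover have "integral {-pi..pi} (\<lambda>x. f (x - Arg w)) = integral {-pi..pi} f"
    by (rule integral_shift_periodic) (auto simp: f_def[abs_def] intro!: continuous_intros)
  ultimately show ?thesis
    by (simp add: f_def[abs_def] has_integral_integral)
qed

lemma cos_eq_half_angle: "cos d = 2 * (cos (d / 2))\<^sup>2 - 1" for d :: real
  using cos_double_cos[of "d / 2"] by simp

lemma norm_exp_add_exp: "norm (exp (\<i> * of_real y) + exp (\<i> * of_real z)) = 2 * \<bar>cos ((y - z) / 2)\<bar>"
proof -
  have "(norm (exp (\<i> * of_real y) + exp (\<i> * of_real z)))\<^sup>2 = (cos y + cos z)\<^sup>2 + (sin y + sin z)\<^sup>2"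
    by (simp add: cmod_power2 flip: cis_conv_exp)
  also have "\<dots> = ((sin y)\<^sup>2 + (cos y)\<^sup>2) + ((sin z)\<^sup>2 + (cos z)\<^sup>2) + 2 * (cos y * cos z + sin y * sin z)"
    by algebra
  also have "\<dots> = 2 + 2 * cos (y - z)"
    by (simp add: cos_diff)
  also have "\<dots> = (2 * \<bar>cos ((y - z) / 2)\<bar>)\<^sup>2"
    by (simp add: cos_eq_half_angle[of "y - z"] power_mult_distrib)
  finally show ?thesis by (rule power2_eq_imp_eq) auto
qed

lemma integral_norm_three_exp:
  "((\<lambda>x. norm (exp (\<i> * of_real x) + exp (\<i> * of_real y) + exp (\<i> * of_real z)) ^ (2 * k)) has_integral
     integral {-pi..pi} (\<lambda>x. triangular_kernel (y - z) x ^ k)) {-pi..pi}"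
proof -
  have "1 + (2 * \<bar>cos ((y - z) / 2)\<bar>)\<^sup>2 + 2 * (2 * \<bar>cos ((y - z) / 2)\<bar>) * cos x =
      triangular_kernel (y - z) x" for x
    by (simp add: triangular_kernel_def cos_eq_half_angle[of "y - z"] power_mult_distrib)
  with integral_norm_exp_add[of "exp (\<i> * of_real y) + exp (\<i> * of_real z)" k]
  show ?thesis by (simp add: norm_exp_add_exp add.assoc)
qed

section \<open>The summands of the nanotube moments\<close>

definition moment_summand :: "nat \<Rightarrow> nat \<Rightarrow> nat \<Rightarrow> int \<Rightarrow> complex" where
  "moment_summand p q k j =
     integral {-pi..pi} (\<lambda>z. integral {-pi..pi} (\<lambda>y. integral {-pi..pi} (\<lambda>x.
       of_real (norm (exp (\<i> * of_real x) + exp (\<i> * of_real y) + exp (\<i> * of_real z)) ^ (2 * k)) *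
       exp (\<i> * of_int j * of_real (real p * (x - z) + real q * (y - z))))))"

text \<open>For \<open>j = 0\<close> the oscillating factor is 1. The integral over \<open>x\<close>
  is a periodic function of \<open>y - z\<close>, so the integral over \<open>y\<close> does not
  depend on \<open>z\<close>, and the integral over \<open>z\<close> only adds a factor
  \<open>2 * pi\<close>.\<close>

lemma moment_summand_0: "moment_summand p q k 0 = of_real ((2 * pi) ^ 3 * triangular_moment k)"
proof -
  define g where "g u = integral {-pi..pi} (\<lambda>x. triangular_kernel u x ^ k)" for u
  have cont: "continuous_on UNIV g"
    unfolding g_def by (intro continuous_on_integral_kernel continuous_intros)
  have per: "g (u + 2 * pi) = g u" for u
  proof -
    \<comment> \<open>Adding \<open>pi\<close> to the half angle flips the sign of its cosine; the
      absolute value in \<open>triangular_kernel\<close> absorbs this.\<close>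
    have half: "(u + 2 * pi) / 2 = u / 2 + pi" by simp
    show ?thesis unfolding g_def triangular_kernel_def half by simp
  qed
  have x: "integral {-pi..pi} (\<lambda>x. complex_of_real
      (norm (exp (\<i> * of_real x) + exp (\<i> * of_real y) + exp (\<i> * of_real z)) ^ (2 * k))) = of_real (g (y - z))"
    for y z unfolding g_def by (intro integral_unique has_integral_of_real integral_norm_three_exp)
  have y: "integral {-pi..pi} (\<lambda>y. complex_of_real (g (y - z))) = of_real (integral {-pi..pi} g)" for z
    unfolding integral_shift_periodic[OF cont per, of z, symmetric]
    by (intro integral_unique has_integral_of_real integrable_integral integrable_continuous_real
        continuous_on_compose2[OF cont] continuous_intros) auto
  have "moment_summand p q k 0 = of_real (2 * pi * integral {-pi..pi} g)"
    by (simp add: moment_summand_def x y flip: of_real_power of_real_mult) (simp add: scaleR_conv_of_real)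
  then show ?thesis
    by (simp add: triangular_moment_def g_def[abs_def] power2_eq_square power3_eq_cube)
qed

text \<open>Already the innermost integral vanishes. For fixed \<open>y\<close> and \<open>z\<close>
  the squared modulus is a Laurent polynomial in \<open>exp (\<i> * of_real x)\<close> with
  exponents between -1 and 1, and the remaining factor has frequency \<open>j * int p\<close> in
  \<open>x\<close>.\<close>

lemma moment_summand_eq_0:
  assumes "int k < \<bar>j * int p\<bar>"
  shows "moment_summand p q k j = 0"
proof -
  have "integral {-pi..pi} (\<lambda>x.
       of_real (norm (exp (\<i> * of_real x) + exp (\<i> * of_real y) + exp (\<i> * of_real z)) ^ (2 * k)) *
       exp (\<i> * of_int j * of_real (real p * (x - z) + real q * (y - z)))) = 0" (is "integral _ ?f = 0") for y z
  proof -
    define w where "w = exp (\<i> * of_real y) + exp (\<i> * of_real z)"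
    define E where "E = exp (\<i> * of_int j * of_real (- real p * z + real q * (y - z)))"
    have eq: "?f x = E * (((1 + w * cnj w) + cnj w * exp (\<i> * of_real x) + w * exp (- (\<i> * of_real x))) ^ k *
        exp (\<i> * of_int (j * int p) * of_real x))" for x
    proof -
      have "of_real ((norm (exp (\<i> * of_real x) + w))\<^sup>2) =
          (exp (\<i> * of_real x) + w) * (exp (- (\<i> * of_real x)) + cnj w)"
        by (simp add: complex_norm_square exp_cnj del: of_real_power)
      also have "\<dots> = (1 + w * cnj w) + cnj w * exp (\<i> * of_real x) + w * exp (- (\<i> * of_real x))"
        by (simp add: algebra_simps flip: exp_add)
      finally have "of_real (norm (exp (\<i> * of_real x) + w) ^ (2 * k)) =
          ((1 + w * cnj w) + cnj w * exp (\<i> * of_real x) + w * exp (- (\<i> * of_real x))) ^ k"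
        by (simp add: power_mult)
      moreover have "exp (\<i> * of_int j * of_real (real p * (x - z) + real q * (y - z))) =
          E * exp (\<i> * of_int (j * int p) * of_real x)"
        by (simp add: E_def algebra_simps flip: exp_add)
      ultimately show ?thesis by (simp add: w_def add.assoc)
    qed
    have "(?f has_integral E * 0) {-pi..pi}"
      unfolding eq by (intro has_integral_mult_right laurent_power_orthogonal assms)
    then show ?thesis by (simp only: mult_zero_right integral_unique)
  qed
  then show ?thesis by (simp add: moment_summand_def)
qed

text \<open>Integrability is not assumed: a non-integrable function has integral 0 by convention, so
  the bound holds in any case. Nested integrals can thus be estimated without checking the inner
  ones for integrability.\<close>

lemma norm_integral_le:
  fixes f :: "real \<Rightarrow> complex"
  assumes "a \<le> b" "0 \<le> B" "\<And>x. norm (f x) \<le> B"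
  shows "norm (integral {a..b} f) \<le> B * (b - a)"
proof (cases "f integrable_on {a..b}")
  case True
  then show ?thesis
    using has_integral_bound[of B f "integral {a..b} f" a b] assms
    by (auto simp: has_integral_integral)
qed (use assms in \<open>simp add: not_integrable_integral\<close>)

text \<open>A sum of three unit vectors has modulus at most 3, so the integrand is at most
  \<open>9 ^ k\<close> on a cube of side \<open>2 * pi\<close>.\<close>

lemma norm_moment_summand_le: "norm (moment_summand p q k j) \<le> (2 * pi) ^ 3 * 9 ^ k"
proof -
  let ?n = "\<lambda>x y z. norm (exp (\<i> * of_real x) + exp (\<i> * of_real y) + exp (\<i> * of_real z))"
  have "?n x y z \<le> 3" for x y z
  proof -
    have "?n x y z \<le> norm (exp (\<i> * of_real x)) + norm (exp (\<i> * of_real y)) + norm (exp (\<i> * of_real z))"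
      by (meson add_right_mono norm_triangle_ineq order_trans)
    then show ?thesis by simp
  qed
  then have "?n x y z ^ (2 * k) \<le> 3 ^ (2 * k)" for x y z
    by (intro power_mono) auto
  then have n: "?n x y z ^ (2 * k) \<le> 9 ^ k" for x y z
    by (simp add: power_mult)
  have "norm (of_real (?n x y z ^ (2 * k)) *
      exp (\<i> * of_int j * of_real (real p * (x - z) + real q * (y - z)))) \<le> 9 ^ k" for x y z
  proof -
    have "norm (exp (\<i> * of_int j * of_real (real p * (x - z) + real q * (y - z)))) = 1"
      by (simp add: norm_exp_eq_Re)
    then show ?thesis using n[of x y z] by (simp add: norm_mult norm_power)
  qed
  then have "norm (moment_summand p q k j) \<le> 9 ^ k * (pi - - pi) * (pi - - pi) * (pi - - pi)"
    unfolding moment_summand_def by (intro norm_integral_le) auto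
  then show ?thesis by (simp add: power3_eq_cube mult_ac)
qed

lemma dual_nanotube_moment_eq_infsum:
  "dual_nanotube_moment p q k = 1 / (2 * of_real pi) ^ 3 * (\<Sum>\<^sub>\<infinity>j. moment_summand p q k j)"
  by (simp add: dual_nanotube_moment_def moment_summand_def)

text \<open>A closed path of fewer than \<open>p\<close> steps cannot wind around the tube: for
  \<open>j \<noteq> 0\<close> the frequency \<open>j * int p\<close> exceeds \<open>k\<close>, and
  only the summand at 0 survives.\<close>

lemma dual_nanotube_moment_eq:
  assumes "k < p"
  shows "dual_nanotube_moment p q k = of_real (triangular_moment k)"
proof -
  have "moment_summand p q k j = 0" if "j \<noteq> 0" for j
  proof (rule moment_summand_eq_0)
    have "1 * int p \<le> \<bar>j\<bar> * int p" using that by (intro mult_right_mono) auto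
    then show "int k < \<bar>j * int p\<bar>" using assms unfolding abs_mult abs_of_nat by linarith
  qed
  then have "infsum (moment_summand p q k) UNIV = infsum (moment_summand p q k) {0}"
    by (intro infsum_cong_neutral) auto
  then show ?thesis
    by (simp add: dual_nanotube_moment_eq_infsum moment_summand_0)
qed

text \<open>At most the \<open>2 * k + 1\<close> summands with \<open>\<bar>j\<bar> \<le> k\<close>
  are non-zero. The bound is uniform in \<open>p\<close> and \<open>q\<close>, as the dominated
  passage to the limit demands.\<close>

lemma norm_dual_nanotube_moment_le:
  assumes "0 < p"
  shows "norm (dual_nanotube_moment p q k) \<le> real (2 * k + 1) * 9 ^ k"
proof -
  let ?J = "{- int k..int k}"
  have "moment_summand p q k j = 0" if "j \<notin> ?J" for j
  proof (rule moment_summand_eq_0)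
    have "\<bar>j\<bar> * 1 \<le> \<bar>j\<bar> * int p" using assms by (intro mult_left_mono) auto
    moreover have "int k < \<bar>j\<bar>" using that by auto
    ultimately show "int k < \<bar>j * int p\<bar>" unfolding abs_mult abs_of_nat by linarith
  qed
  then have "infsum (moment_summand p q k) UNIV = infsum (moment_summand p q k) ?J"
    by (intro infsum_cong_neutral) auto
  also have "norm \<dots> \<le> of_nat (card ?J) * ((2 * pi) ^ 3 * 9 ^ k)"
    unfolding infsum_finite[OF finite_atLeastAtMost_int] by (intro sum_norm_bound norm_moment_summand_le)
  finally have "norm (infsum (moment_summand p q k) UNIV) \<le> real (2 * k + 1) * 9 ^ k * (2 * pi) ^ 3"
    by (simp add: mult_ac add_ac)
  then show ?thesis
    by (simp add: dual_nanotube_moment_eq_infsum norm_mult norm_divide norm_power pos_divide_le_eq)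
qed

section \<open>The moment generating function as a power series in the moments\<close>

text \<open>Almost surely \<open>\<bar>X \<omega>\<bar> \<le> B\<close>, so the exponential series
  of \<open>\<bar>t * B\<bar>\<close> dominates and expectation and sum may be exchanged.\<close>

lemma mgf_sums:
  assumes "prob_space M" "X \<in> borel_measurable M" "compactly_supported_rv M X"
  shows "(\<lambda>k. t ^ k / fact k * (\<integral>\<omega>. X \<omega> ^ k \<partial>M)) sums mgf M X t"
proof -
  interpret prob_space M by fact
  obtain B where "0 \<le> B" and B: "AE \<omega> in M. \<bar>X \<omega>\<bar> \<le> B"
  proof -
    obtain K where K: "compact K" "AE \<omega> in M. X \<omega> \<in> K"
      using assms(3) by (auto simp: compactly_supported_rv_def)
    obtain B where "B > 0" "\<And>x. x \<in> K \<Longrightarrow> norm x \<le> B"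
      using compact_imp_bounded[OF K(1)] by (auto simp: bounded_pos)
    with K(2) show thesis by (intro that[of B]) auto
  qed
  let ?f = "\<lambda>k \<omega>. t ^ k / fact k * X \<omega> ^ k"
  have le: "AE \<omega> in M. norm (?f k \<omega>) \<le> \<bar>t * B\<bar> ^ k / fact k" for k
    using B
  proof eventually_elim
    case (elim \<omega>)
    then have "\<bar>X \<omega>\<bar> ^ k \<le> B ^ k" by (intro power_mono) auto
    then have "\<bar>t\<bar> ^ k * \<bar>X \<omega>\<bar> ^ k / fact k \<le> \<bar>t\<bar> ^ k * B ^ k / fact k"
      by (intro divide_right_mono mult_left_mono) auto
    then show ?case using \<open>0 \<le> B\<close> by (simp add: abs_mult power_abs power_mult_distrib)
  qed
  have sm: "summable (\<lambda>k. \<bar>t * B\<bar> ^ k / fact k)"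
    using summable_exp[of "\<bar>t * B\<bar>"] by (simp add: divide_inverse mult.commute)
  have int: "integrable M (?f k)" for k
    using le[of k] assms(2) by (intro integrable_const_bound) auto
  have "(\<lambda>k. \<integral>\<omega>. ?f k \<omega> \<partial>M) sums (\<integral>\<omega>. (\<Sum>k. ?f k \<omega>) \<partial>M)"
  proof (rule sums_integral[OF int])
    have "summable (\<lambda>k. norm (?f k \<omega>))" for \<omega>
      using summable_exp[of "\<bar>t * X \<omega>\<bar>"]
      by (simp add: divide_inverse abs_mult power_abs power_mult_distrib mult_ac)
    then show "AE \<omega> in M. summable (\<lambda>k. norm (?f k \<omega>))" by simp
    show "summable (\<lambda>k. \<integral>\<omega>. norm (?f k \<omega>) \<partial>M)"
    proof (rule summable_comparison_test'[OF sm])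
      fix k :: nat
      have "(\<integral>\<omega>. norm (?f k \<omega>) \<partial>M) \<le> \<bar>t * B\<bar> ^ k / fact k"
        using le[of k] by (intro integral_le_const integrable_norm[OF int]) auto
      then show "norm (\<integral>\<omega>. norm (?f k \<omega>) \<partial>M) \<le> \<bar>t * B\<bar> ^ k / fact k"
        by simp
    qed
  qed
  moreover have "(\<Sum>k. ?f k \<omega>) = exp (t * X \<omega>)" for \<omega>
    by (simp add: exp_def power_mult_distrib divide_inverse mult_ac)
  ultimately show ?thesis by (simp add: mgf_def)
qed

section \<open>Generating series of the triangular lattice moments\<close>

lemma integral_even:
  fixes f :: "real \<Rightarrow> real"
  assumes "continuous_on {-a..a} f" "\<And>x. f (- x) = f x" "0 \<le> a"
  shows "integral {-a..a} f = 2 * integral {0..a} f"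
proof -
  have "integral {-a..0} f + integral {0..a} f = integral {-a..a} f"
    using assms by (intro Henstock_Kurzweil_Integration.integral_combine integrable_continuous_real) auto
  moreover have "integral {-a..0} f = integral {0..a} f"
    using Henstock_Kurzweil_Integration.integral_reflect_real[where a = 0 and b = a and f = f]
      assms(2) by simp
  ultimately show ?thesis by simp
qed

text \<open>Summing under both integrals turns the powers of the kernel into
  \<open>exp (t * triangular_kernel u x)\<close>. Evenness in \<open>u\<close> halves the range, and
  the integral over \<open>x\<close> is then a value of \<open>bessel_I0\<close>.\<close>

lemma triangular_moment_generating_series:
  "(\<lambda>k. t ^ k / fact k * triangular_moment k) sums
     (exp (3 * t) / pi * integral {0..pi} (\<lambda>\<theta>. exp (2 * t * cos \<theta>) * bessel_I0 (4 * t * cos (\<theta> / 2))))"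
proof -
  let ?K = triangular_kernel
  let ?B = "\<lambda>k. \<bar>9 * t\<bar> ^ k / fact k"
  define G where "G u = integral {-pi..pi} (\<lambda>x. exp (t * ?K u x))" for u
  have sm: "summable ?B"
    using summable_exp[of "\<bar>9 * t\<bar>"] by (simp add: divide_inverse mult.commute)
  have bound: "\<bar>t ^ k / fact k * ?K u x ^ k\<bar> \<le> ?B k" for k u x
  proof -
    have "\<bar>?K u x\<bar> ^ k \<le> 9 ^ k" by (intro power_mono triangular_kernel_bound) auto
    then have "\<bar>t\<bar> ^ k * \<bar>?K u x\<bar> ^ k / fact k \<le> \<bar>t\<bar> ^ k * 9 ^ k / fact k"
      by (intro divide_right_mono mult_left_mono) auto
    then show ?thesis by (simp add: abs_mult power_abs power_mult_distrib mult.commute)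
  qed
  have cont_K: "continuous_on A (?K u)" for A u
    unfolding triangular_kernel_def by (intro continuous_intros)
  have inner: "(\<lambda>k. integral {-pi..pi} (\<lambda>x. t ^ k / fact k * ?K u x ^ k)) sums G u" for u
  proof -
    have "(\<lambda>k. integral {-pi..pi} (\<lambda>x. t ^ k / fact k * ?K u x ^ k)) sums
        integral {-pi..pi} (\<lambda>x. \<Sum>k. t ^ k / fact k * ?K u x ^ k)"
      by (rule sums_integral_uniform[OF _ bound sm]) (auto intro!: continuous_intros cont_K)
    moreover have "(\<Sum>k. t ^ k / fact k * ?K u x ^ k) = exp (t * ?K u x)" for x
      by (simp add: exp_def power_mult_distrib divide_inverse mult_ac)
    ultimately show ?thesis by (simp add: G_def)
  qed
  \<comment> \<open>Second exchange, now for the outer integral: the majorant is that of the inner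
    one times the length \<open>2 * pi\<close> of the interval.\<close>
  have "(\<lambda>k. integral {-pi..pi} (\<lambda>u. integral {-pi..pi} (\<lambda>x. t ^ k / fact k * ?K u x ^ k))) sums
      integral {-pi..pi} (\<lambda>u. \<Sum>k. integral {-pi..pi} (\<lambda>x. t ^ k / fact k * ?K u x ^ k))"
  proof (rule sums_integral_uniform[OF _ _ summable_mult2[OF sm]])
    show "continuous_on {-pi..pi} (\<lambda>u. integral {-pi..pi} (\<lambda>x. t ^ k / fact k * ?K u x ^ k))" for k
      by (intro continuous_on_integral_kernel continuous_intros)
    fix k u
    have "norm (integral {-pi..pi} (\<lambda>x. t ^ k / fact k * ?K u x ^ k)) \<le> ?B k * (pi - - pi)"
    proof (rule integral_bound)
      show "norm (t ^ k / fact k * ?K u x ^ k) \<le> ?B k" for x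
        unfolding real_norm_def by (rule bound)
    qed (auto intro!: continuous_intros cont_K)
    then show "\<bar>integral {-pi..pi} (\<lambda>x. t ^ k / fact k * ?K u x ^ k)\<bar> \<le> ?B k * (pi - - pi)"
      by (simp only: real_norm_def)
  qed
  then have "(\<lambda>k. t ^ k / fact k * integral {-pi..pi} (\<lambda>u. integral {-pi..pi} (\<lambda>x. ?K u x ^ k))) sums
      integral {-pi..pi} G"
    using inner by (simp add: sums_iff)
  then have "(\<lambda>k. t ^ k / fact k * triangular_moment k) sums (integral {-pi..pi} G / (2 * pi)\<^sup>2)"
    using sums_divide[where c = "(2 * pi)\<^sup>2"] unfolding triangular_moment_def by fastforce
  moreover have "integral {-pi..pi} G = 2 * integral {0..pi} G"
  proof (rule integral_even)
    show "continuous_on {-pi..pi} G"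
      unfolding G_def by (intro continuous_on_integral_kernel continuous_intros)
  qed (auto simp: G_def triangular_kernel_def)
  moreover have "G \<theta> = 2 * pi * exp (3 * t) * (exp (2 * t * cos \<theta>) * bessel_I0 (4 * t * cos (\<theta> / 2)))"
    if "\<theta> \<in> {0..pi}" for \<theta>
  proof -
    have "0 \<le> cos (\<theta> / 2)" using that by (intro cos_ge_zero) auto
    then have "exp (t * ?K \<theta> x) = exp (3 * t) * exp (2 * t * cos \<theta>) * exp (4 * t * cos (\<theta> / 2) * cos x)" for x
      by (simp add: triangular_kernel_def algebra_simps flip: exp_add)
    then show ?thesis by (simp add: G_def integral_exp_cos_eq_bessel_I0)
  qed
  then have "integral {0..pi} G = integral {0..pi}
      (\<lambda>\<theta>. 2 * pi * exp (3 * t) * (exp (2 * t * cos \<theta>) * bessel_I0 (4 * t * cos (\<theta> / 2))))"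
    by (rule Henstock_Kurzweil_Integration.integral_cong)
  then have "integral {0..pi} G =
      2 * pi * exp (3 * t) * integral {0..pi} (\<lambda>\<theta>. exp (2 * t * cos \<theta>) * bessel_I0 (4 * t * cos (\<theta> / 2)))"
    by simp
  \<comment> \<open>The factor 2 from evenness, the \<open>2 * pi\<close> from the Bessel integral
    and the division by \<open>(2 * pi)\<^sup>2\<close> combine to \<open>1 / pi\<close>.\<close>
  ultimately show ?thesis
    by (simp add: power2_eq_square)
qed

section \<open>Convergence of the moment generating functions\<close>

theorem proposition3:
  fixes c t :: real
    and M :: "nat \<Rightarrow> nat \<Rightarrow> 'a measure"
    and \<Lambda> :: "nat \<Rightarrow> nat \<Rightarrow> 'a \<Rightarrow> real"
    and p q :: "nat \<Rightarrow> nat"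
  assumes "c \<in> {0..1}"
    and "\<And>a b. (a, b) \<in> nanotube_params \<Longrightarrow> dual_nanotube_eigenvalue a b (M a b) (\<Lambda> a b)"
    and "\<And>n. (p n, q n) \<in> nanotube_params"
    and "filterlim (\<lambda>n. p n + q n) at_top sequentially"
    and "(\<lambda>n. real (p n) / real (p n + q n)) \<longlonglongrightarrow> c"
  shows "(\<lambda>n. mgf (M (p n) (q n)) (\<Lambda> (p n) (q n)) t) \<longlonglongrightarrow>
           exp (3 * t) / pi *
           integral {0..pi} (\<lambda>\<theta>. exp (2 * t * cos \<theta>) * bessel_I0 (4 * t * cos (\<theta> / 2)))"
proof -
  define X where "X k n = (\<integral>\<omega>. \<Lambda> (p n) (q n) \<omega> ^ k \<partial>M (p n) (q n))" for k n
  have ev: "dual_nanotube_eigenvalue (p n) (q n) (M (p n) (q n)) (\<Lambda> (p n) (q n))" for n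
    using assms(2,3) by blast
  then have X: "complex_of_real (X k n) = dual_nanotube_moment (p n) (q n) k" for k n
    by (simp add: dual_nanotube_eigenvalue_def X_def)
  have pq: "q n \<le> p n" "0 < p n" for n
    using assms(3)[of n] by (auto simp: nanotube_params_def)
  have lim: "(\<lambda>n. t ^ k / fact k * X k n) \<longlonglongrightarrow> t ^ k / fact k * triangular_moment k" for k
  \<comment> \<open>Each coefficient is eventually constant: since \<open>q n \<le> p n\<close>, a
    sum \<open>p n + q n\<close> above \<open>2 * k\<close> forces \<open>k < p n\<close>.\<close>
  proof (rule tendsto_eventually)
    have "\<forall>\<^sub>F n in sequentially. Suc (2 * k) \<le> p n + q n"
      using assms(4) unfolding filterlim_at_top by blast
    then show "\<forall>\<^sub>F n in sequentially. t ^ k / fact k * X k n = t ^ k / fact k * triangular_moment k"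
    proof eventually_elim
      case (elim n)
      then have "k < p n" using pq(1)[of n] by linarith
      then show ?case using X[of k n] by (simp add: dual_nanotube_moment_eq)
    qed
  qed
  have bound: "\<bar>t ^ k / fact k * X k n\<bar> \<le> real (2 * k + 1) * \<bar>9 * t\<bar> ^ k / fact k" for k n
  proof -
    have "\<bar>X k n\<bar> \<le> real (2 * k + 1) * 9 ^ k"
      using norm_dual_nanotube_moment_le[OF pq(2), of n "q n" k] by (simp flip: X)
    then have "\<bar>t\<bar> ^ k / fact k * \<bar>X k n\<bar> \<le> \<bar>t\<bar> ^ k / fact k * (real (2 * k + 1) * 9 ^ k)"
      by (intro mult_left_mono) auto
    then show ?thesis by (simp add: abs_mult power_abs power_mult_distrib mult_ac)
  qed
  have "summable (\<lambda>k. real (2 * k + 1) * \<bar>9 * t\<bar> ^ k / fact k)"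
  proof (rule summable_comparison_test')
    \<comment> \<open>The linear factor is absorbed by doubling the base from 9 to 18, as
      \<open>k < 2 ^ k\<close> gives \<open>2 * k + 1 \<le> 2 * 2 ^ k\<close>.\<close>
    show "summable (\<lambda>k. 2 * \<bar>18 * t\<bar> ^ k / fact k)"
      using summable_mult[OF summable_exp[of "\<bar>18 * t\<bar>"], of 2] by (simp add: divide_inverse mult_ac)
    fix k :: nat
    have "2 * k + 1 \<le> 2 * 2 ^ k"
      using less_exp[of k] by linarith
    then have "real (2 * k + 1) \<le> 2 * 2 ^ k"
      by (metis of_nat_le_iff of_nat_mult of_nat_numeral of_nat_power)
    then have "real (2 * k + 1) * \<bar>9 * t\<bar> ^ k / fact k \<le> 2 * 2 ^ k * \<bar>9 * t\<bar> ^ k / fact k"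
      by (intro divide_right_mono mult_right_mono) auto
    also have "\<dots> = 2 * (2 * \<bar>9 * t\<bar>) ^ k / fact k"
      by (simp only: power_mult_distrib mult.assoc)
    also have "2 * \<bar>9 * t\<bar> = \<bar>18 * t\<bar>"
      by simp
    finally show "norm (real (2 * k + 1) * \<bar>9 * t\<bar> ^ k / fact k) \<le> 2 * \<bar>18 * t\<bar> ^ k / fact k"
      by simp
  qed
  moreover have "\<forall>\<^sub>F (k, n) in sequentially \<times>\<^sub>F sequentially.
      norm (t ^ k / fact k * X k n) \<le> real (2 * k + 1) * \<bar>9 * t\<bar> ^ k / fact k"
    by (intro always_eventually) (simp only: split_beta real_norm_def bound simp_thms)
  ultimately have "(\<lambda>n. \<Sum>k. t ^ k / fact k * X k n) \<longlonglongrightarrow> (\<Sum>k. t ^ k / fact k * triangular_moment k)"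
    using tannerys_theorem[of "\<lambda>k n. t ^ k / fact k * X k n", OF lim] by simp
  moreover have "(\<Sum>k. t ^ k / fact k * X k n) = mgf (M (p n) (q n)) (\<Lambda> (p n) (q n)) t" for n
    using ev[of n] unfolding X_def
    by (intro sums_unique[symmetric] mgf_sums) (auto simp: dual_nanotube_eigenvalue_def)
  ultimately show ?thesis
    using sums_unique[OF triangular_moment_generating_series[of t]] by simp
qed

end
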